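(* Let $0\le\alpha<\beta$ be real numbers. Consider the random sequence $(X_n)_{n\ge1}$ with $X_1=\frac11$ and, given $X_n=\frac ab$ (reduced), $X_{n+1}=\frac{a}{a+b}$ with probability $\frac12$ and $X_{n+1}=\frac{a+b}{b}$ with probability $\frac12$, the choices at different steps being independent. Then with probability $1$ there exists $m\in\mathbb{N}$ such that $X_m\in(\alpha,\beta)$.
   Context: The sequence $(X_n)$ is a random walk down the Calkin--Wilf tree (the binary tree with root $\frac11$ in which $\frac ab$ has children $\frac{a}{a+b}$ and $\frac{a+b}{b}$), moving at each step to the left or right child with equal probability. *)

theory Defs
  imports "HOL-Probability.Probability"
begin

text \<open>
  \<^const>\<open>quotient_of\<close> returns the reduced representation of a rational number, with positive
  denominator, so the two functions below are the children in the Calkin--Wilf tree.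
\<close>

definition cw_left :: "rat \<Rightarrow> rat" where
  "cw_left q = (case quotient_of q of (a, b) \<Rightarrow> Fract a (a + b))"

definition cw_right :: "rat \<Rightarrow> rat" where
  "cw_right q = (case quotient_of q of (a, b) \<Rightarrow> Fract (a + b) b)"

text \<open>
  The choice \<open>C n\<close> is made at step \<open>n\<close>, leading from \<open>X n\<close> to \<open>X (n + 1)\<close>; the value \<open>True\<close>
  means left. Time starts at 1, so \<open>X 0\<close> and \<open>C 0\<close> are irrelevant.
  The starting value and the transitions are only required to hold almost surely, so that
  the notion depends only on the joint law of the \<open>X n\<close>, \<open>C n\<close> with \<open>n \<ge> 1\<close>.
\<close>

locale calkin_wilf_walk = prob_space M
  for M :: "'a measure" +
  fixes X :: "nat \<Rightarrow> 'a \<Rightarrow> rat" and C :: "nat \<Rightarrow> 'a \<Rightarrow> bool"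
  assumes X_random_variable: "\<And>n. n \<ge> 1 \<Longrightarrow> random_variable (count_space UNIV) (X n)"
    and C_indep: "indep_vars (\<lambda>_. count_space UNIV) C {1..}"
    and C_fair: "\<And>n. n \<ge> 1 \<Longrightarrow> prob {\<omega> \<in> space M. C n \<omega>} = 1 / 2"
    and X_start: "AE \<omega> in M. X 1 \<omega> = 1"
    and X_step: "\<And>n. n \<ge> 1 \<Longrightarrow>
      AE \<omega> in M. X (n + 1) \<omega> = (if C n \<omega> then cw_left (X n \<omega>) else cw_right (X n \<omega>))"

end

theory Submission imports Defs begin

text \<open>
  As maps on the positive rationals, the steps are \<open>L: x \<mapsto> x / (1 + x)\<close> and \<open>R: x \<mapsto> x + 1\<close>.
  The word \<open>R\<^sup>N L\<close> sends every positive rational into \<open>(1 - 1 / (N + 1), 1)\<close>, and every positive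
  rational \<open>q\<close> is the image of 1 under some word (Euclid's algorithm); as both steps are
  1-Lipschitz, some finite word sends all positive rationals into \<open>(\<alpha>, \<beta>)\<close>, whatever the current
  state of the walk. Almost surely this word occurs among the independent fair choices.
\<close>

text \<open>The argument order makes \<open>fold cw_step w x\<close> the state reached from
  \<open>x\<close> by following the word \<open>w\<close>, first letter first; appending a letter to
  \<open>w\<close> adds a last step.\<close>

definition cw_step :: "bool \<Rightarrow> rat \<Rightarrow> rat" where
  "cw_step c x = (if c then cw_left x else cw_right x)"

lemma cw_left_pos:
  assumes "x > 0"
  shows "cw_left x = x / (1 + x)"
proof -
  obtain a b where ab: "quotient_of x = (a, b)" by force
  have b: "b > 0" using quotient_of_denom_pos[OF ab] .
  have x: "x = of_int a / of_int b" using quotient_of_div[OF ab] .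
  have a: "a > 0" using assms b unfolding x by (simp add: zero_less_divide_iff)
  have "of_int a + of_int b \<noteq> (0::rat)" using a b by (smt (verit) of_int_add of_int_eq_0_iff)
  moreover have "cw_left x = of_int a / (of_int a + of_int b)"
    by (simp add: cw_left_def ab Fract_of_int_quotient)
  ultimately show ?thesis
    using a b by (simp add: x field_simps)
qed

lemma cw_right_eq: "cw_right x = x + 1"
proof -
  obtain a b where ab: "quotient_of x = (a, b)" by force
  have "b > 0" using quotient_of_denom_pos[OF ab] .
  then show ?thesis
    using quotient_of_div[OF ab] by (simp add: cw_right_def ab Fract_of_int_quotient field_simps)
qed

lemma cw_step_pos: "x > 0 \<Longrightarrow> cw_step c x > 0"
  by (simp add: cw_step_def cw_left_pos cw_right_eq)

lemma fold_cw_step_pos: "x > 0 \<Longrightarrow> fold cw_step w x > 0"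
  by (induction w arbitrary: x) (simp_all add: cw_step_pos)

text \<open>The right step is a translation; the left step divides the difference by (1 + x)(1 + y),
  which is at least 1.\<close>

lemma cw_step_lipschitz:
  assumes "x > 0" "y > 0"
  shows "\<bar>cw_step c x - cw_step c y\<bar> \<le> \<bar>x - y\<bar>"
proof (cases c)
  case True
  have "x / (1 + x) - y / (1 + y) = (x - y) / ((1 + x) * (1 + y))"
    using assms by (simp add: divide_simps) (simp add: algebra_simps)
  then have "\<bar>x / (1 + x) - y / (1 + y)\<bar> = \<bar>x - y\<bar> / ((1 + x) * (1 + y))"
    using assms by (simp add: abs_mult)
  also have "\<dots> \<le> \<bar>x - y\<bar> / 1"
  proof (rule divide_left_mono)
    have "1 * 1 \<le> (1 + x) * (1 + y)"
      using assms by (intro mult_mono) auto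
    then show "1 \<le> (1 + x) * (1 + y)" by simp
  qed (use assms in auto)
  finally show ?thesis using True assms by (simp add: cw_step_def cw_left_pos)
qed (simp add: cw_step_def cw_right_eq)

lemma fold_cw_right: "fold cw_step (replicate n False) x = x + of_nat n"
  by (induction n arbitrary: x) (simp_all add: cw_step_def cw_right_eq)

text \<open>After N right steps the state exceeds N, and a left step takes y to 1 - 1/(1 + y). The
  error is thus below 1/N for every starting point at once.\<close>

lemma cw_word_near_one:
  assumes "\<delta> > 0"
  shows "\<exists>w. w \<noteq> [] \<and> (\<forall>x>0. \<bar>fold cw_step w x - 1\<bar> < \<delta>)"
proof -
  obtain N where N: "1 / \<delta> < of_nat N" using reals_Archimedean2 by blast
  have "\<bar>fold cw_step (replicate N False @ [True]) x - 1\<bar> < \<delta>" if x: "x > 0" for x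
  proof -
    have "fold cw_step (replicate N False @ [True]) x = (x + of_nat N) / (1 + (x + of_nat N))"
      using x by (simp add: fold_cw_right cw_step_def[of True] cw_left_pos add_pos_nonneg del: fold_replicate)
    also have "\<dots> - 1 = - (1 / (1 + (x + of_nat N)))"
      using x by (simp add: divide_simps)
    finally have "\<bar>fold cw_step (replicate N False @ [True]) x - 1\<bar> = 1 / (1 + (x + of_nat N))"
      using x by simp
    also have "\<dots> < \<delta>"
    proof -
      have "1 / \<delta> < 1 + (x + of_nat N)" using N x by linarith
      then show ?thesis using x assms by (simp add: field_simps)
    qed
    finally show ?thesis .
  qed
  then show ?thesis by (intro exI[of _ "replicate N False @ [True]"]) simp
qed

text \<open>Subtractive Euclidean algorithm: a/b is a child of (a - b)/b or of a/(b - a), and the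
  descent ends at a = b, where the target is 1.\<close>

lemma cw_word_near:
  assumes "\<delta> > 0" "a > 0" "b > 0"
  shows "\<exists>w. w \<noteq> [] \<and> (\<forall>x>0. \<bar>fold cw_step w x - of_nat a / of_nat b\<bar> < \<delta>)"
  using assms(2,3)
proof (induction "a + b" arbitrary: a b rule: less_induct)
  case less
  have step: "\<exists>w. w \<noteq> [] \<and> (\<forall>x>0. \<bar>fold cw_step w x - of_nat a / of_nat b\<bar> < \<delta>)"
    if "a' > 0" "b' > 0" "a' + b' < a + b"
      and eq: "cw_step c (of_nat a' / of_nat b') = of_nat a / of_nat b" for a' b' c
  proof -
    obtain w where w: "w \<noteq> []" "\<And>x. x > 0 \<Longrightarrow> \<bar>fold cw_step w x - of_nat a' / of_nat b'\<bar> < \<delta>"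
      using less.hyps \<open>a' > 0\<close> \<open>b' > 0\<close> \<open>a' + b' < a + b\<close> by blast
    \<comment> \<open>The step \<open>c\<close> maps the parent exactly to a/b, so by the Lipschitz
      bound it preserves the error \<delta>.\<close>
    have "\<bar>fold cw_step (w @ [c]) x - of_nat a / of_nat b\<bar> < \<delta>" if "x > 0" for x
      using cw_step_lipschitz[OF fold_cw_step_pos[OF that, of w], of "of_nat a' / of_nat b'" c]
        w(2)[OF that] \<open>a' > 0\<close> \<open>b' > 0\<close> eq by simp
    then show ?thesis by (intro exI[of _ "w @ [c]"]) simp
  qed
  consider "a = b" | "a > b" | "a < b" by linarith
  then show ?case
  proof cases
    case 1
    then show ?thesis using cw_word_near_one[OF assms(1)] less.prems by simp
  next
    case 2
    then show ?thesis
      using less.prems by (intro step[of "a - b" b False])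
        (simp_all add: cw_step_def cw_right_eq of_nat_diff field_simps)
  next
    case 3
    then show ?thesis
      using less.prems by (intro step[of a "b - a" True])
        (simp_all add: cw_step_def cw_left_pos of_nat_diff field_simps)
  qed
qed

lemma cw_word_into_interval:
  fixes \<alpha> \<beta> :: real
  assumes "0 \<le> \<alpha>" "\<alpha> < \<beta>"
  shows "\<exists>w. w \<noteq> [] \<and> (\<forall>x>0. real_of_rat (fold cw_step w x) \<in> {\<alpha><..<\<beta>})"
proof -
  obtain q where q: "\<alpha> < real_of_rat q" "real_of_rat q < \<beta>"
    using of_rat_dense[OF assms(2)] by blast
  have qpos: "q > 0" using q(1) assms(1) by (metis le_less_trans zero_less_of_rat_iff)
  obtain i j where ij: "quotient_of q = (i, j)" by force
  have j: "j > 0" and qij: "q = of_int i / of_int j"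
    using quotient_of_denom_pos[OF ij] quotient_of_div[OF ij] by auto
  have i: "i > 0" using qpos j unfolding qij by (simp add: zero_less_divide_iff)
  have q_nat: "q = of_nat (nat i) / of_nat (nat j)" using i j qij by simp
  \<comment> \<open>The radius must be rational, since the walk lives in \<open>rat\<close>; it is
    taken below the distance from \<open>q\<close> to both endpoints.\<close>
  have "0 < min (real_of_rat q - \<alpha>) (\<beta> - real_of_rat q)" using q by simp
  then obtain \<delta> where \<delta>: "0 < real_of_rat \<delta>"
    "real_of_rat \<delta> < min (real_of_rat q - \<alpha>) (\<beta> - real_of_rat q)"
    using of_rat_dense by blast
  then have "\<delta> > 0" by simp
  then obtain w where w: "w \<noteq> []" "\<And>x. x > 0 \<Longrightarrow> \<bar>fold cw_step w x - q\<bar> < \<delta>"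
    using cw_word_near[of \<delta> "nat i" "nat j"] i j unfolding q_nat by auto
  have "real_of_rat (fold cw_step w x) \<in> {\<alpha><..<\<beta>}" if "x > 0" for x
  proof -
    have "q - \<delta> < fold cw_step w x" "fold cw_step w x < q + \<delta>" using w(2)[OF that] by linarith+
    then have "real_of_rat (q - \<delta>) < real_of_rat (fold cw_step w x)"
      "real_of_rat (fold cw_step w x) < real_of_rat (q + \<delta>)"
      by (simp_all only: of_rat_less)
    then show ?thesis using \<delta>(2) by (simp add: of_rat_add of_rat_diff)
  qed
  then show ?thesis using w(1) by blast
qed

text \<open>Cut time from \<open>s\<close> on into disjoint blocks of length l =
  \<open>length w\<close>. The blocks spell \<open>w\<close> independently, each with probability
  (1/2)^l, so the first n all fail with probability (1 - (1/2)^l)^n, which tends to 0.\<close>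

lemma (in prob_space) AE_fair_word_occurs:
  fixes C :: "nat \<Rightarrow> 'a \<Rightarrow> bool"
  assumes indep: "indep_vars (\<lambda>_. count_space UNIV) C {s..}"
    and fair: "\<And>n. n \<ge> s \<Longrightarrow> prob {\<omega> \<in> space M. C n \<omega>} = 1 / 2"
    and "w \<noteq> []"
  shows "AE \<omega> in M. \<exists>k\<ge>s. \<forall>j<length w. C (k + j) \<omega> = w ! j"
proof -
  define l where "l = length w"
  have l: "l > 0" using assms(3) by (simp add: l_def)
  define B where "B k = {k * l + s..<k * l + s + l}" for k
  \<comment> \<open>\<open>E k\<close> is written as a function of the choices restricted to
    \<open>B k\<close>, so that it inherits independence from the blocks.\<close>
  define Y where "Y k g \<longleftrightarrow> (\<forall>j<l. g (k * l + s + j) = w ! j)" for k and g :: "nat \<Rightarrow> bool"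
  define E where "E k \<omega> = Y k (\<lambda>i\<in>B k. C i \<omega>)" for k \<omega>
  have E_iff: "E k \<omega> \<longleftrightarrow> (\<forall>j<l. C (k * l + s + j) \<omega> = w ! j)" for k \<omega>
    by (simp add: E_def Y_def B_def)
  have "disjoint_family B"
  proof -
    \<comment> \<open>A time determines the index of its block by division.\<close>
    have "(i - s) div l = k" if "i \<in> B k" for i k
      using that l by (intro div_nat_eqI) (auto simp: B_def algebra_simps)
    then show ?thesis unfolding disjoint_family_on_def by blast
  qed
  moreover have "B k \<subseteq> {s..}" for k by (auto simp: B_def)
  ultimately have "indep_vars (\<lambda>k. PiM (B k) (\<lambda>_. count_space UNIV)) (\<lambda>k \<omega>. \<lambda>i\<in>B k. C i \<omega>) UNIV"
    by (intro indep_vars_restrict[OF indep])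
  then have indepE: "indep_vars (\<lambda>_. count_space UNIV) E UNIV"
    unfolding E_def
  proof (rule indep_vars_compose2)
    fix k
    have [measurable]: "(\<lambda>g. g (k * l + s + j)) \<in> PiM (B k) (\<lambda>_. count_space UNIV) \<rightarrow>\<^sub>M count_space (UNIV :: bool set)"
      if "j < l" for j
      using that by (intro measurable_component_singleton) (simp add: B_def)
    show "Y k \<in> PiM (B k) (\<lambda>_. count_space UNIV) \<rightarrow>\<^sub>M count_space UNIV"
      unfolding Y_def by measurable
  qed
  have coin: "prob (C n -` {b} \<inter> space M) = 1 / 2" if "n \<ge> s" for n b
  proof (cases b)
    case True
    have "C n -` {True} \<inter> space M = {\<omega> \<in> space M. C n \<omega>}" by auto
    then show ?thesis using fair[OF that] True by simp
  next
    case False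
    have [measurable]: "C n \<in> M \<rightarrow>\<^sub>M count_space UNIV"
      using indep that by (simp add: indep_vars_def)
    have "C n -` {False} \<inter> space M = space M - {\<omega> \<in> space M. C n \<omega>}" by auto
    then show ?thesis
      using prob_compl[of "{\<omega> \<in> space M. C n \<omega>}"] fair[OF that] False by simp
  qed
  have probE: "prob (E k -` {True} \<inter> space M) = (1 / 2) ^ l" for k
  proof -
    have "E k -` {True} \<inter> space M
        = (\<Inter>i\<in>B k. C i -` {w ! (i - (k * l + s))} \<inter> space M)"
    proof -
      have "E k \<omega> \<longleftrightarrow> (\<forall>i\<in>B k. C i \<omega> = w ! (i - (k * l + s)))" for \<omega>
      proof -
        have "B k = (+) (k * l + s) ` {..<l}"
          by (simp add: B_def lessThan_atLeast0 add.commute)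
        then show ?thesis by (auto simp: E_iff)
      qed
      \<comment> \<open>An empty intersection would be \<open>UNIV\<close> instead of a subset of
        \<open>space M\<close>; \<open>n > 0\<close> guards against the same in
        \<open>bound\<close>.\<close>
      moreover have "B k \<noteq> {}" using l by (simp add: B_def)
      ultimately show ?thesis by auto
    qed
    also have "prob \<dots> = (\<Prod>i\<in>B k. prob (C i -` {w ! (i - (k * l + s))} \<inter> space M))"
      using l by (intro indep_varsD[OF indep]) (auto simp: B_def)
    also have "\<dots> = (\<Prod>i\<in>B k. 1 / 2)"
      by (intro prod.cong refl coin) (simp add: B_def)
    finally show ?thesis by (simp add: B_def)
  qed
  have E_rv [measurable]: "E k \<in> M \<rightarrow>\<^sub>M count_space UNIV" for k
    using indepE by (simp add: indep_vars_def)
  have prob_notE: "prob (E k -` {False} \<inter> space M) = 1 - (1 / 2) ^ l" for k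
  proof -
    have "E k -` {False} \<inter> space M = space M - (E k -` {True} \<inter> space M)" by auto
    then show ?thesis using prob_compl[of "E k -` {True} \<inter> space M"] by (simp add: probE)
  qed
  define N where "N = {\<omega> \<in> space M. \<forall>k. \<not> E k \<omega>}"
  have [measurable]: "N \<in> sets M" unfolding N_def by measurable
  have bound: "prob N \<le> (1 - (1 / 2) ^ l) ^ n" if "n > 0" for n
  proof -
    have "prob N \<le> prob (\<Inter>k\<in>{..<n}. E k -` {False} \<inter> space M)"
    proof (rule finite_measure_mono)
      show "(\<Inter>k\<in>{..<n}. E k -` {False} \<inter> space M) \<in> sets M"
        using that by (intro sets.finite_INT measurable_sets[OF E_rv]) auto
    qed (use that in \<open>auto simp: N_def\<close>)
    also have "\<dots> = (\<Prod>k<n. prob (E k -` {False} \<inter> space M))"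
      using that by (intro indep_varsD[OF indepE]) auto
    finally show ?thesis by (simp add: prob_notE)
  qed
  have "(\<lambda>n. (1 - (1 / 2 :: real) ^ l) ^ n) \<longlonglongrightarrow> 0"
    using l by (intro LIMSEQ_power_zero) (simp add: power_le_one)
  then have "prob N \<le> 0"
    by (rule LIMSEQ_le_const) (use bound in \<open>auto intro!: exI[of _ 1]\<close>)
  then have "prob N = 0" by (simp add: measure_le_0_iff)
  then have "AE \<omega> in M. \<omega> \<notin> N"
    by (intro AE_not_in) (simp add: null_sets_def emeasure_eq_measure)
  with AE_space show ?thesis
  proof eventually_elim
    case (elim \<omega>)
    then obtain k where "E k \<omega>" by (auto simp: N_def)
    then show ?case
      by (intro exI[of _ "k * l + s"]) (simp add: E_iff l_def)
  qed
qed

theorem theorem4: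
  fixes \<alpha> \<beta> :: real
    and M :: "'a measure"
    and X :: "nat \<Rightarrow> 'a \<Rightarrow> rat"
    and C :: "nat \<Rightarrow> 'a \<Rightarrow> bool"
  assumes "0 \<le> \<alpha>" and "\<alpha> < \<beta>"
    and "calkin_wilf_walk M X C"
  shows "AE \<omega> in M. \<exists>m\<ge>1. real_of_rat (X m \<omega>) \<in> {\<alpha><..<\<beta>}"
proof -
  interpret calkin_wilf_walk M X C by fact
  obtain w where w: "w \<noteq> []" "\<And>x. x > 0 \<Longrightarrow> real_of_rat (fold cw_step w x) \<in> {\<alpha><..<\<beta>}"
    using cw_word_into_interval[OF assms(1,2)] by blast
  \<comment> \<open>Countably many almost sure transitions hold simultaneously.\<close>
  have "AE \<omega> in M. \<forall>n\<ge>1. X (n + 1) \<omega> = cw_step (C n \<omega>) (X n \<omega>)"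
    using X_step by (simp add: AE_all_countable cw_step_def)
  moreover have "AE \<omega> in M. \<exists>k\<ge>1. \<forall>j<length w. C (k + j) \<omega> = w ! j"
    using C_indep C_fair w(1) by (rule AE_fair_word_occurs)
  ultimately show ?thesis
    using X_start
  proof eventually_elim
    case (elim \<omega>)
    have pos: "X n \<omega> > 0" if "n \<ge> 1" for n
      using that
    proof (induction n rule: dec_induct)
      case (step n)
      then show ?case using elim(1) by (simp add: cw_step_pos)
    qed (use elim(3) in simp)
    obtain k where k: "k \<ge> 1" "\<And>j. j < length w \<Longrightarrow> C (k + j) \<omega> = w ! j"
      using elim(2) by blast
    \<comment> \<open>The choice \<open>C (k + j)\<close> leads out of \<open>X (k + j)\<close>, so
      that state has consumed exactly the first j letters; the whole word is consumed at time
      \<open>k + length w\<close>.\<close>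
    have "X (k + j) \<omega> = fold cw_step (take j w) (X k \<omega>)" if "j \<le> length w" for j
      using that
    proof (induction j)
      case (Suc j)
      then show ?case
        using elim(1)[rule_format, of "k + j"] k by (simp add: take_Suc_conv_app_nth)
    qed simp
    from this[of "length w"] have "real_of_rat (X (k + length w) \<omega>) \<in> {\<alpha><..<\<beta>}"
      using w(2)[OF pos[OF k(1)]] by simp
    then show ?case using k(1) by (intro exI[of _ "k + length w"]) simp
  qed
qed

end
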